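(* Let $\gamma > 0$ and $\tau < 0$, and let $F \in \mathcal{F}(\gamma,\tau)$, with associated function $\delta$ (both defined in the context). Then, as $u \to \infty$, $$\sup_{y \geq 1} \left| \frac{\overline{F}(uy)}{\overline{F}(u)} - \overline{G}_{\gamma,\delta(u),\tau}(y) \right| = o\{|\delta(u)|\},$$ $$\sup_{x \geq 0} \left| \frac{\overline{F}(u+x)}{\overline{F}(u)} - \overline{H}_{\gamma,\delta(u),\tau}(x/u) \right| = o\{|\delta(u)|\}.$$
   Context: For a distribution function $F$ on $\mathbb{R}$ write $\overline{F} = 1 - F$ (similarly $\overline{G} = 1-G$, $\overline{H} = 1-H$). A positive measurable function $f$ defined in a right neighborhood of infinity is regularly varying with index $\beta \in \mathbb{R}$, written $f \in \mathcal{R}_\beta$, if $\lim_{u\to\infty} f(ux)/f(u) = x^\beta$ for all $x \in (0,\infty)$. The class $\mathcal{F}(\gamma,\tau)$ ($\gamma>0$, $\tau<0$): a distribution function $F$ belongs to $\mathcal{F}(\gamma,\tau)$ if $x^{1/\gamma}\overline{F}(x) \to C \in (0,\infty)$ as $x \to \infty$ and if the function $\delta$ defined via $\overline{F}(x) = C x^{-1/\gamma}\{1 + \gamma^{-1}\delta(x)\}$ is eventually nonzero and of constant sign and satisfies $|\delta| \in \mathcal{R}_\tau$. (In particular $\delta(x) \to 0$ as $x\to\infty$.) Extended Pareto Distribution (EPD): for parameters $\tau < 0 < \gamma$ and $\delta > \max(-1, 1/\tau)$, its distribution function is $G_{\gamma,\delta,\tau}(y) = 1 - \{y(1+\delta-\delta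 y^\tau)\}^{-1/\gamma}$ for $y > 1$ and $G_{\gamma,\delta,\tau}(y) = 0$ for $y \leq 1$. Extended Generalized Pareto Distribution (EGPD): its distribution function is $H_{\gamma,\delta,\tau}(x) = G_{\gamma,\delta,\tau}(1+x)$, $x \in \mathbb{R}$. *)

theory Defs
  imports "HOL-Probability.Distribution_Functions" "HOL-Library.Landau_Symbols"
begin

definition distribution_function :: "(real \<Rightarrow> real) \<Rightarrow> bool" where
  "distribution_function F \<longleftrightarrow> (\<exists>M. real_distribution M \<and> F = cdf M)"

definition survival :: "(real \<Rightarrow> real) \<Rightarrow> real \<Rightarrow> real" where
  "survival F x = 1 - F x"

(* Only the behaviour of f on some right neighbourhood {a<..} of infinity matters; values of the
   total function f elsewhere are irrelevant. *)
definition regularly_varying :: "(real \<Rightarrow> real) \<Rightarrow> real \<Rightarrow> bool" where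
  "regularly_varying f \<beta> \<longleftrightarrow>
     (\<exists>a. set_borel_measurable borel {a<..} f \<and> (\<forall>x>a. f x > 0)) \<and>
     (\<forall>x>0. ((\<lambda>u. f (u * x) / f u) \<longlongrightarrow> x powr \<beta>) at_top)"

(* F belongs to the class with parameters \<gamma> and \<tau>, and \<delta> is its associated function.
   The defining equation of \<delta> is imposed on x > 0, where the real power x powr (-1/\<gamma>) is meaningful;
   there it determines \<delta> uniquely, since C is the limit of x powr (1/\<gamma>) * survival F x.
   Values \<delta> x for x \<le> 0 are unconstrained and irrelevant. *)
definition second_order_pareto ::
    "real \<Rightarrow> real \<Rightarrow> (real \<Rightarrow> real) \<Rightarrow> (real \<Rightarrow> real) \<Rightarrow> bool" where
  "second_order_pareto \<gamma> \<tau> F \<delta> \<longleftrightarrow>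
     distribution_function F \<and>
     (\<exists>C>0. ((\<lambda>x. x powr (1/\<gamma>) * survival F x) \<longlongrightarrow> C) at_top \<and>
            (\<forall>x>0. survival F x = C * x powr (-1/\<gamma>) * (1 + \<delta> x / \<gamma>))) \<and>
     (eventually (\<lambda>x. \<delta> x > 0) at_top \<or> eventually (\<lambda>x. \<delta> x < 0) at_top) \<and>
     regularly_varying (\<lambda>x. \<bar>\<delta> x\<bar>) \<tau>"

(* A distribution function when \<tau> < 0 < \<gamma> and \<delta> > max (-1) (1/\<tau>); for other parameters it is
   just the value of the formula. Along \<delta> = \<delta>(u) with u tending to infinity the parameter range is
   eventually respected, since \<delta>(u) tends to 0. *)
definition EPD :: "real \<Rightarrow> real \<Rightarrow> real \<Rightarrow> real \<Rightarrow> real" where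
  "EPD \<gamma> \<delta> \<tau> y = (if y > 1 then 1 - (y * (1 + \<delta> - \<delta> * y powr \<tau>)) powr (-1/\<gamma>) else 0)"

definition EGPD :: "real \<Rightarrow> real \<Rightarrow> real \<Rightarrow> real \<Rightarrow> real" where
  "EGPD \<gamma> \<delta> \<tau> x = EPD \<gamma> \<delta> \<tau> (1 + x)"

lemma second_order_pareto_tendsto_0:
  assumes "\<gamma> > 0" "second_order_pareto \<gamma> \<tau> F \<delta>"
  shows "(\<delta> \<longlongrightarrow> 0) at_top"
proof -
  obtain C where C: "C > 0" and lim: "((\<lambda>x. x powr (1/\<gamma>) * survival F x) \<longlongrightarrow> C) at_top"
    and eq: "\<And>x. x > 0 \<Longrightarrow> survival F x = C * x powr (-1/\<gamma>) * (1 + \<delta> x / \<gamma>)"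
    using assms(2) unfolding second_order_pareto_def by blast
  have "((\<lambda>x. \<gamma> * (x powr (1/\<gamma>) * survival F x / C - 1)) \<longlongrightarrow> \<gamma> * (C / C - 1)) at_top"
    using C by (intro tendsto_intros lim) auto
  moreover have "eventually (\<lambda>x. \<gamma> * (x powr (1/\<gamma>) * survival F x / C - 1) = \<delta> x) at_top"
    using eventually_gt_at_top[of 0]
  proof eventually_elim
    case (elim x)
    have "x powr (1/\<gamma>) * x powr (-1/\<gamma>) = 1"
      using elim by (simp add: powr_add[symmetric])
    then have "x powr (1/\<gamma>) * survival F x = C * (1 + \<delta> x / \<gamma>)"
      unfolding eq[OF elim] by (metis mult.assoc mult.left_commute mult_1)
    then show ?case using C assms(1) by (simp add: field_simps)
  qed
  ultimately show ?thesis
    using C by (auto dest: Lim_transform_eventually)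
qed

(* The suprema of interest are taken over bounded sets for all large u, so that the
   real-valued SUP is the genuine supremum. *)
lemma EPD_error_bdd_above:
  assumes "\<gamma> > 0" "\<tau> < 0" "second_order_pareto \<gamma> \<tau> F \<delta>"
  shows "eventually (\<lambda>u. bdd_above ((\<lambda>y. \<bar>survival F (u * y) / survival F u
           - survival (EPD \<gamma> (\<delta> u) \<tau>) y\<bar>) ` {1..})) at_top"
proof -
  obtain M where "real_distribution M" and F: "F = cdf M"
    using assms(3) unfolding second_order_pareto_def distribution_function_def by blast
  then interpret real_distribution M by simp
  have surv01: "0 \<le> survival F x" "survival F x \<le> 1" for x
    by (simp_all add: survival_def F cdf_bounded_prob cdf_nonneg)
  have "eventually (\<lambda>u. \<bar>\<delta> u\<bar> < 1/2) at_top"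
    using order_tendstoD(2)[OF tendsto_rabs[OF second_order_pareto_tendsto_0[OF assms(1,3)]], of "1/2"]
    by simp
  then show ?thesis
  proof eventually_elim
    case (elim u)
    let ?K = "1 / survival F u + (1 + (1/2) powr (-1/\<gamma>))"
    have "\<bar>survival F (u * y) / survival F u - survival (EPD \<gamma> (\<delta> u) \<tau>) y\<bar> \<le> ?K"
      if y: "y \<ge> 1" for y
    proof -
      have p: "0 \<le> y powr \<tau>" "y powr \<tau> \<le> 1"
        using y assms(2) powr_mono[of \<tau> 0 y] by auto
      have "\<bar>\<delta> u * (1 - y powr \<tau>)\<bar> \<le> 1/2 * 1"
        unfolding abs_mult using p elim by (intro mult_mono) auto
      then have h: "1 + \<delta> u - \<delta> u * y powr \<tau> \<ge> 1/2"
        unfolding right_diff_distrib by linarith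
      then have "1 * (1/2) \<le> y * (1 + \<delta> u - \<delta> u * y powr \<tau>)"
        using y by (intro mult_mono) auto
      then have "(y * (1 + \<delta> u - \<delta> u * y powr \<tau>)) powr (-1/\<gamma>) \<le> (1/2) powr (-1/\<gamma>)"
        using assms(1) by (intro powr_mono2') auto
      then have "\<bar>survival (EPD \<gamma> (\<delta> u) \<tau>) y\<bar> \<le> 1 + (1/2) powr (-1/\<gamma>)"
        by (auto simp: survival_def EPD_def)
      moreover have "\<bar>survival F (u * y) / survival F u\<bar> \<le> 1 / survival F u"
        using surv01 by (simp add: divide_right_mono)
      ultimately show ?thesis by linarith
    qed
    then show ?case by (intro bdd_aboveI2[where M = ?K]) auto
  qed
qed

lemma EGPD_error_bdd_above:
  assumes "\<gamma> > 0" "\<tau> < 0" "second_order_pareto \<gamma> \<tau> F \<delta>"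
  shows "eventually (\<lambda>u. bdd_above ((\<lambda>x. \<bar>survival F (u + x) / survival F u
           - survival (EGPD \<gamma> (\<delta> u) \<tau>) (x / u)\<bar>) ` {0..})) at_top"
  using EPD_error_bdd_above[OF assms] eventually_gt_at_top[of 0]
proof eventually_elim
  case (elim u)
  have "(\<lambda>x. \<bar>survival F (u + x) / survival F u - survival (EGPD \<gamma> (\<delta> u) \<tau>) (x / u)\<bar>) ` {0..}
      \<subseteq> (\<lambda>y. \<bar>survival F (u * y) / survival F u - survival (EPD \<gamma> (\<delta> u) \<tau>) y\<bar>) ` {1..}"
  proof (rule image_subsetI)
    fix x :: real assume "x \<in> {0..}"
    then show "\<bar>survival F (u + x) / survival F u - survival (EGPD \<gamma> (\<delta> u) \<tau>) (x / u)\<bar>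
      \<in> (\<lambda>y. \<bar>survival F (u * y) / survival F u - survival (EPD \<gamma> (\<delta> u) \<tau>) y\<bar>) ` {1..}"
      using elim(2)
      by (intro image_eqI[where x = "1 + x / u"])
         (auto simp: survival_def EGPD_def distrib_left)
  qed
  then show ?case using elim(1) by (rule bdd_above_mono[rotated])
qed

end

theory Submission
  imports Defs
begin

text \<open>
  Write \<open>d = \<delta>(u)\<close> and \<open>r = \<delta>(uy) / \<delta>(u)\<close>. Dividing the defining equation of \<open>\<delta>\<close> at \<open>uy\<close> by the
  one at \<open>u\<close> cancels the constant \<open>C\<close>, so the two survival functions to be compared are
  \<open>y\<^sup>-\<^sup>1\<^sup>/\<^sup>\<gamma> (1 + d r / \<gamma>) / (1 + d / \<gamma>)\<close> and \<open>y\<^sup>-\<^sup>1\<^sup>/\<^sup>\<gamma> (1 + d (1 - y\<^sup>\<tau>))\<^sup>-\<^sup>1\<^sup>/\<^sup>\<gamma>\<close>. To first order in \<open>d\<close>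
  the factors after \<open>y\<^sup>-\<^sup>1\<^sup>/\<^sup>\<gamma>\<close> are \<open>1 + d (r - 1) / \<gamma>\<close> and \<open>1 + d (y\<^sup>\<tau> - 1) / \<gamma>\<close>. They differ by
  \<open>d (r - y\<^sup>\<tau>) / \<gamma>\<close>, and the remainders are \<open>o(d)\<close> uniformly in \<open>y \<ge> 1\<close> because \<open>y\<^sup>\<tau>\<close> and \<open>r\<close> stay
  bounded. Since \<open>y\<^sup>-\<^sup>1\<^sup>/\<^sup>\<gamma> \<le> 1\<close>, everything reduces to \<open>r \<longlongrightarrow> y\<^sup>\<tau>\<close> uniformly in \<open>y \<ge> 1\<close>.

  Regular variation gives this convergence only for each fixed \<open>y\<close>. That it is uniform on compact
  sets is Karamata's uniform convergence theorem, which rests on the measurability of \<open>\<delta>\<close>: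
  after taking logarithms it is the statement \<open>additive_uniform_convergence\<close> about a measurable \<open>h\<close>
  with \<open>h(t + s) - h(t) \<longlongrightarrow> 0\<close> for every \<open>s\<close>. The negative index makes it uniform up to infinity
  (\<open>regularly_varying_uniform_at_infinity\<close>): both \<open>r\<close> and \<open>y\<^sup>\<tau>\<close> are small for large \<open>y\<close>, \<open>r\<close> by
  chaining the bound on a single block \<open>[1, K]\<close>.

  The second supremum is the first one under the substitution \<open>y = 1 + x / u\<close>.
\<close>

section \<open>Uniform convergence for slowly varying functions, in additive form\<close>

text \<open>
  Pointwise convergence along a sequence \<open>x\<close> becomes uniform off a set of small measure, as in
  Egorov's theorem: every shift in \<open>[0, L]\<close> eventually joins the increasing sets \<open>V n\<close>, so their
  measures exhaust that of the interval.
\<close>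

lemma measure_uniformly_good_shifts_tendsto:
  fixes h :: "real \<Rightarrow> real" and x :: "nat \<Rightarrow> real"
  assumes [measurable]: "h \<in> borel_measurable borel"
    and lim: "\<And>s. ((\<lambda>t. h (t + s) - h t) \<longlongrightarrow> 0) at_top"
    and x: "filterlim x at_top sequentially" and "\<epsilon> > 0" "L \<ge> 0"
  defines "V \<equiv> \<lambda>n. {y \<in> {0..L}. \<forall>m\<ge>n. \<bar>h (x m + y) - h (x m)\<bar> < \<epsilon>}"
  shows "V n \<in> sets lborel" and "(\<lambda>n. measure lborel (V n)) \<longlonglongrightarrow> L"
proof -
  have V[measurable]: "V n \<in> sets lborel" for n
    unfolding V_def by measurable
  then show "V n \<in> sets lborel" .
  have Un: "(\<Union>n. V n) = {0..L}"
  proof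
    show "{0..L} \<subseteq> (\<Union>n. V n)"
    proof
      fix y assume y: "y \<in> {0..L}"
      have "(\<lambda>m. h (x m + y) - h (x m)) \<longlonglongrightarrow> 0"
        by (rule filterlim_compose[OF lim x])
      then have "eventually (\<lambda>m. \<bar>h (x m + y) - h (x m)\<bar> < \<epsilon>) sequentially"
        using \<open>\<epsilon> > 0\<close> by (auto dest!: tendstoD simp: dist_real_def)
      then show "y \<in> (\<Union>n. V n)"
        using y by (auto simp: V_def eventually_sequentially)
    qed
  qed (auto simp: V_def)
  have "incseq V"
    unfolding incseq_def V_def by auto
  moreover have "range V \<subseteq> sets lborel"
    using V by blast
  moreover have "emeasure lborel (\<Union>n. V n) \<noteq> \<infinity>"
    unfolding Un using \<open>L \<ge> 0\<close> by simp
  ultimately have "(\<lambda>n. measure lborel (V n)) \<longlonglongrightarrow> measure lborel (\<Union>n. V n)"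
    by (intro Lim_measure_incseq)
  then show "(\<lambda>n. measure lborel (V n)) \<longlonglongrightarrow> L"
    using \<open>L \<ge> 0\<close> by (simp add: Un)
qed

text \<open>
  If uniformity failed along points \<open>t n\<close> and \<open>t n + s n\<close>, then shifts that are good for \<open>t n\<close> and
  shifts that are good for \<open>t n + s n\<close> would each fill most of an interval longer than \<open>A\<close>. The
  offset \<open>s n\<close> is at most \<open>A\<close>, so for reasons of measure some point \<open>t n + y\<close> is reached by good
  shifts from both, and comparing \<open>h\<close> at both points with its value there bounds
  \<open>h(t n + s n) - h(t n)\<close>.
\<close>

lemma additive_uniform_convergence:
  fixes h :: "real \<Rightarrow> real"
  assumes h: "h \<in> borel_measurable borel"
    and lim: "\<And>s. ((\<lambda>t. h (t + s) - h t) \<longlongrightarrow> 0) at_top"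
    and "\<epsilon> > 0"
  shows "eventually (\<lambda>t. \<forall>s\<in>{0..A}. \<bar>h (t + s) - h t\<bar> < \<epsilon>) at_top"
proof (rule ccontr)
  assume "\<not> ?thesis"
  then have "\<forall>n. \<exists>t s. t \<ge> real n \<and> s \<in> {0..A} \<and> \<not> \<bar>h (t + s) - h t\<bar> < \<epsilon>"
    unfolding eventually_at_top_linorder by blast
  then obtain t s where t: "\<And>n. t n \<ge> real n" and s: "\<And>n. s n \<in> {0..A}"
    and bad: "\<And>n. \<not> \<bar>h (t n + s n) - h (t n)\<bar> < \<epsilon>"
    by metis
  have s0: "0 \<le> s n" "s n \<le> A" for n
    using s[of n] by auto
  have "A \<ge> 0"
    using s0[of 0] by linarith
  have t_lim: "filterlim t at_top sequentially"
    using t by (intro filterlim_at_top_mono[OF filterlim_real_sequentially]) auto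
  have ts_lim: "filterlim (\<lambda>n. t n + s n) at_top sequentially"
    using t s0 by (intro filterlim_at_top_mono[OF filterlim_real_sequentially])
      (auto intro!: always_eventually add_increasing2)
  (* V n and the translate of W n lie in an interval of length L + A. Each misses measure less
     than 1/2, so they must meet as soon as 2 L - 1 >= L + A. *)
  define L where "L = A + 1"
  define V where "V n = {y \<in> {0..L}. \<forall>m\<ge>n. \<bar>h (t m + y) - h (t m)\<bar> < \<epsilon>/2}" for n
  define W where "W n = {y \<in> {0..L}. \<forall>m\<ge>n. \<bar>h (t m + s m + y) - h (t m + s m)\<bar> < \<epsilon>/2}" for n
  have L: "L \<ge> 0" and e2: "\<epsilon>/2 > 0"
    using \<open>A \<ge> 0\<close> \<open>\<epsilon> > 0\<close> by (auto simp: L_def)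
  note V = measure_uniformly_good_shifts_tendsto[OF h lim t_lim e2 L, folded V_def]
  note W = measure_uniformly_good_shifts_tendsto[OF h lim ts_lim e2 L, folded W_def]
  have "eventually (\<lambda>n. measure lborel (V n) > L - 1/2 \<and> measure lborel (W n) > L - 1/2) sequentially"
    by (intro eventually_conj order_tendstoD(1)[OF V(2)] order_tendstoD(1)[OF W(2)]) auto
  then obtain n where n: "measure lborel (V n) > L - 1/2" "measure lborel (W n) > L - 1/2"
    by (auto simp: eventually_sequentially)
  define W' where "W' = (\<lambda>w. s n + w) ` W n"
  have W'_eq: "W' = (\<lambda>y. y - s n) -` W n"
    by (auto simp: W'_def image_iff algebra_simps) (metis add.commute diff_add_cancel)
  have W'[measurable]: "W' \<in> sets lborel"
    using W(1)[of n] measurable_sets_borel[of "\<lambda>y. y - s n" borel "W n"] unfolding W'_eq by simp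
  have mW': "measure lborel W' = measure lborel (W n)"
    using measure_translation[of "s n" "W n"] W(1)[of n] W'
    by (simp add: W'_def[symmetric] measure_completion)
  have fin: "emeasure lborel X < \<infinity>" if "X \<subseteq> {0..L + A}" "X \<in> sets lborel" for X
    using emeasure_mono[OF that(1), of lborel] \<open>A \<ge> 0\<close> L
    by (auto simp: le_less_trans)
  have VW: "V n \<subseteq> {0..L + A}" "W' \<subseteq> {0..L + A}"
    using s0[of n] \<open>A \<ge> 0\<close> by (fastforce simp: V_def W'_def W_def)+
  have "V n \<inter> W' \<noteq> {}"
  proof
    assume disj: "V n \<inter> W' = {}"
    have "measure lborel (V n) + measure lborel W' = measure lborel (V n \<union> W')"
      using V(1)[of n] W' fin[OF VW(1)] fin[OF VW(2)] disj
      by (intro measure_Union[symmetric]) auto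
    also have "\<dots> \<le> measure lborel {0..L + A}"
      using VW V(1)[of n] W' fin[of "{0..L + A}"]
      by (intro measure_mono_fmeasurable fmeasurableI) auto
    also have "\<dots> = L + A"
      using \<open>A \<ge> 0\<close> L by simp
    finally show False
      using n mW' by (simp add: L_def)
  qed
  then obtain y w where y: "y \<in> V n" and w: "w \<in> W n" and yw: "y = s n + w"
    by (auto simp: W'_def)
  have "\<bar>h (t n + y) - h (t n)\<bar> < \<epsilon>/2" "\<bar>h (t n + s n + w) - h (t n + s n)\<bar> < \<epsilon>/2"
    using y w by (auto simp: V_def W_def)
  then show False
    using bad[of n] unfolding yw add.assoc by linarith
qed

section \<open>Uniform convergence for regularly varying functions\<close>

text \<open>
  Karamata's uniform convergence theorem on compact sets to the right of 1. The logarithm of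
  \<open>f(x) / x\<^sup>\<beta>\<close>, as a function of \<open>t = ln x\<close>, turns ratios into differences; undoing the logarithm
  turns the uniform absolute error into a relative one.
\<close>

lemma regularly_varying_uniform_compact:
  assumes rv: "regularly_varying f \<beta>" and "\<epsilon> > 0"
  shows "eventually (\<lambda>u. \<forall>y\<in>{1..Y}. \<bar>f (u * y) / f u - y powr \<beta>\<bar> \<le> \<epsilon> * y powr \<beta>) at_top"
proof -
  obtain a where meas: "set_borel_measurable borel {a<..} f" and pos: "\<And>x. x > a \<Longrightarrow> f x > 0"
    and lim: "\<And>x. x > 0 \<Longrightarrow> ((\<lambda>u. f (u * x) / f u) \<longlongrightarrow> x powr \<beta>) at_top"
    using rv unfolding regularly_varying_def by blast
  (* Cutting f off below a makes it measurable on the whole line without changing it near infinity. *)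
  define g where "g x = indicator {a<..} x *\<^sub>R f x" for x
  have [measurable]: "g \<in> borel_measurable borel"
    using meas unfolding set_borel_measurable_def g_def .
  define h where "h t = ln (g (exp t)) - \<beta> * t" for t
  have h: "h \<in> borel_measurable borel"
    unfolding h_def by measurable
  have h_diff: "h (t + s) - h t = ln (f (exp t * exp s) / f (exp t) / exp s powr \<beta>)"
    if "exp t > a" "exp (t + s) > a" for t s
    using that pos[OF that(1)] pos[OF that(2)]
    by (simp add: h_def g_def ln_div exp_add ln_mult algebra_simps)
  have "((\<lambda>t. h (t + s) - h t) \<longlongrightarrow> 0) at_top" for s
  proof (rule Lim_transform_eventually)
    have "((\<lambda>t. f (exp t * exp s) / f (exp t)) \<longlongrightarrow> exp s powr \<beta>) at_top"
      by (rule filterlim_compose[OF lim exp_at_top]) simp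
    then have "((\<lambda>t. ln (f (exp t * exp s) / f (exp t) / exp s powr \<beta>))
        \<longlongrightarrow> ln (exp s powr \<beta> / exp s powr \<beta>)) at_top"
      by (intro tendsto_intros) auto
    then show "((\<lambda>t. ln (f (exp t * exp s) / f (exp t) / exp s powr \<beta>)) \<longlongrightarrow> 0) at_top"
      by simp
    have "filterlim (\<lambda>t. exp (t + s)) at_top at_top"
      unfolding add.commute[of _ s]
      by (rule filterlim_compose[OF exp_at_top
          filterlim_tendsto_add_at_top[OF tendsto_const filterlim_ident]])
    then have "eventually (\<lambda>t. exp (t + s) > a) at_top" "eventually (\<lambda>t. exp t > a) at_top"
      using exp_at_top by (auto simp: filterlim_at_top_dense)
    then show "eventually (\<lambda>t. ln (f (exp t * exp s) / f (exp t) / exp s powr \<beta>)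
        = h (t + s) - h t) at_top"
      by eventually_elim (simp add: h_diff)
  qed
  note additive = additive_uniform_convergence[OF h this]
  have "(exp \<longlongrightarrow> exp 0) (nhds (0::real))"
    by (rule isCont_tendsto_compose[OF _ filterlim_ident]) simp
  then have "eventually (\<lambda>z::real. \<bar>exp z - 1\<bar> < \<epsilon>) (nhds 0)"
    using \<open>\<epsilon> > 0\<close> by (auto dest!: tendstoD simp: dist_real_def)
  then obtain \<eta> where "\<eta> > 0" and \<eta>: "\<And>z. \<bar>z\<bar> < \<eta> \<Longrightarrow> \<bar>exp z - 1\<bar> < \<epsilon>"
    by (auto simp: eventually_nhds_metric dist_real_def)
  have "eventually (\<lambda>u. \<forall>s\<in>{0..ln Y}. \<bar>h (ln u + s) - h (ln u)\<bar> < \<eta>) at_top"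
    by (rule eventually_compose_filterlim[OF additive[OF \<open>\<eta> > 0\<close>] ln_at_top])
  then show ?thesis
    using eventually_gt_at_top[of "max a 0"]
  proof eventually_elim
    case (elim u)
    then have u: "u > a" "u > 0"
      by auto
    show ?case
    proof
      fix y assume y: "y \<in> {1..Y}"
      have "u * y \<ge> u"
        using u y by simp
      then have uy: "u * y > a" "u * y > 0"
        using u by linarith+
      define q where "q = f (u * y) / f u / y powr \<beta>"
      have "q > 0"
        using pos[OF u(1)] pos[OF uy(1)] y by (auto simp: q_def)
      have "ln q = h (ln u + ln y) - h (ln u)"
        using h_diff[of "ln u" "ln y"] u uy y by (simp add: exp_add q_def)
      then have "\<bar>ln q\<bar> < \<eta>"
        using elim y by simp
      then have "\<bar>q - 1\<bar> < \<epsilon>"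
        using \<eta>[of "ln q"] \<open>q > 0\<close> by simp
      have "f (u * y) / f u - y powr \<beta> = (q - 1) * y powr \<beta>"
        using y by (simp add: q_def field_simps)
      then show "\<bar>f (u * y) / f u - y powr \<beta>\<bar> \<le> \<epsilon> * y powr \<beta>"
        using \<open>\<bar>q - 1\<bar> < \<epsilon>\<close> by (simp add: abs_mult mult_right_mono)
    qed
  qed
qed

text \<open>
  A factor \<open>y\<close> is reached by steps of size \<open>K\<close>, none of which increases \<open>f\<close>, followed by one factor
  in \<open>[1, K]\<close>; hence the constant \<open>c\<close> of a single block is paid only once.
\<close>

lemma geometric_chaining_bound:
  fixes f :: "real \<Rightarrow> real"
  assumes "K > 1" "U > 0"
    and nonneg: "\<And>u. u \<ge> U \<Longrightarrow> f u \<ge> 0"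
    and step: "\<And>u. u \<ge> U \<Longrightarrow> f (u * K) \<le> f u"
    and block: "\<And>u y. u \<ge> U \<Longrightarrow> y \<in> {1..K} \<Longrightarrow> f (u * y) \<le> c * f u"
    and "c \<ge> 0" "u \<ge> U" "y \<ge> 1"
  shows "f (u * y) \<le> c * f u"
proof -
  have "\<forall>u y. u \<ge> U \<longrightarrow> y \<in> {1..K ^ Suc n} \<longrightarrow> f (u * y) \<le> c * f u" for n
  proof (induction n)
    case 0
    then show ?case using block by simp
  next
    case (Suc n)
    show ?case
    proof (intro allI impI)
      fix u y assume u: "u \<ge> U" and y: "y \<in> {1..K ^ Suc (Suc n)}"
      show "f (u * y) \<le> c * f u"
      proof (cases "y \<le> K")
        case True
        then show ?thesis using block u y by simp
      next
        case False
        have "u * K \<ge> U"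
          using u \<open>K > 1\<close> \<open>U > 0\<close> mult_left_mono[of 1 K u] by linarith
        moreover have "y / K \<in> {1..K ^ Suc n}"
          using False y \<open>K > 1\<close> by (simp add: field_simps)
        ultimately have "f (u * K * (y / K)) \<le> c * f (u * K)"
          using Suc.IH by blast
        also have "\<dots> \<le> c * f u"
          using step[OF u] \<open>c \<ge> 0\<close> by (rule mult_left_mono)
        finally show ?thesis using \<open>K > 1\<close> by simp
      qed
    qed
  qed
  moreover obtain n where "y < K ^ n"
    using real_arch_pow[OF \<open>K > 1\<close>] by blast
  moreover have "K ^ n \<le> K ^ Suc n"
    using \<open>K > 1\<close> by (intro power_increasing) auto
  ultimately show ?thesis
    using \<open>u \<ge> U\<close> \<open>y \<ge> 1\<close> by (meson atLeastAtMost_iff less_imp_le order_trans)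
qed

text \<open>
  Below a large \<open>K\<close> this is uniformity on a compact set. Beyond \<open>K\<close> both terms are small on
  their own: \<open>y\<^sup>\<beta> \<le> K\<^sup>\<beta>\<close>, and \<open>f(uy) \<le> 2 f(uK) \<le> 4 K\<^sup>\<beta> f(u)\<close> by chaining.
\<close>

lemma regularly_varying_uniform_at_infinity:
  assumes rv: "regularly_varying f \<beta>" and "\<beta> < 0" "\<epsilon> > 0"
  shows "eventually (\<lambda>u. \<forall>y\<ge>1. \<bar>f (u * y) / f u - y powr \<beta>\<bar> \<le> \<epsilon>) at_top"
proof -
  obtain a where pos: "\<And>x. x > a \<Longrightarrow> f x > 0"
    using rv unfolding regularly_varying_def by blast
  have powr_le_1: "y powr \<beta> \<le> 1" if "y \<ge> 1" for y
    using that \<open>\<beta> < 0\<close> powr_mono[of \<beta> 0 y] by auto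
  have "((\<lambda>K::real. K powr \<beta>) \<longlongrightarrow> 0) at_top"
    using \<open>\<beta> < 0\<close> by (rule tendsto_neg_powr) (rule filterlim_ident)
  (* K powr \<beta> < 1/2 makes a step of size K decrease f, despite the factor 2 lost to the relative
     error; K powr \<beta> < \<epsilon>/4 pays for the two factors 2 beyond K. *)
  then have "eventually (\<lambda>K::real. K powr \<beta> < min (\<epsilon>/4) (1/2)) at_top"
    using \<open>\<epsilon> > 0\<close> by (intro order_tendstoD(2)) auto
  then have "eventually (\<lambda>K::real. K powr \<beta> < min (\<epsilon>/4) (1/2) \<and> K > 1) at_top"
    by (intro eventually_conj eventually_gt_at_top)
  then obtain K :: real where K: "K powr \<beta> < \<epsilon>/4" "K powr \<beta> < 1/2" "K > 1"
    by (auto dest: eventually_happens'[rotated])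
  define \<eta> where "\<eta> = min \<epsilon> 1"
  have "\<eta> > 0" "\<eta> \<le> \<epsilon>" "\<eta> \<le> 1"
    using \<open>\<epsilon> > 0\<close> by (auto simp: \<eta>_def)
  have "eventually (\<lambda>u. u > max a 0 \<and>
      (\<forall>y\<in>{1..K}. \<bar>f (u * y) / f u - y powr \<beta>\<bar> \<le> \<eta> * y powr \<beta>)) at_top"
    by (intro eventually_conj eventually_gt_at_top
        regularly_varying_uniform_compact[OF rv \<open>\<eta> > 0\<close>])
  then obtain U where U: "\<And>u. u \<ge> U \<Longrightarrow> u > max a 0"
    and unif: "\<And>u y. u \<ge> U \<Longrightarrow> y \<in> {1..K} \<Longrightarrow> \<bar>f (u * y) / f u - y powr \<beta>\<bar> \<le> \<eta> * y powr \<beta>"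
    unfolding eventually_at_top_linorder by blast
  have "U > 0" and fpos: "f u > 0" if "u \<ge> U" for u
    using U[of U] U[OF that] pos[of u] by auto
  then have "U > 0" by blast
  have block: "f (u * y) \<le> 2 * y powr \<beta> * f u" if "u \<ge> U" "y \<in> {1..K}" for u y
  proof -
    have "f (u * y) / f u \<le> (1 + \<eta>) * y powr \<beta>"
      using unif[OF that] by (simp add: algebra_simps abs_le_iff)
    also have "\<dots> \<le> 2 * y powr \<beta>"
      using \<open>\<eta> \<le> 1\<close> by (intro mult_right_mono) auto
    finally show ?thesis
      using fpos[OF that(1)] by (simp add: field_simps)
  qed
  have bound: "f (u * y) \<le> 2 * f u" if "u \<ge> U" "y \<ge> 1" for u y
  proof (rule geometric_chaining_bound[where f = f, OF \<open>K > 1\<close> \<open>U > 0\<close> _ _ _ _ that])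
    fix u assume u: "u \<ge> U"
    show "f u \<ge> 0"
      using fpos[OF u] by simp
    have "2 * K powr \<beta> * f u \<le> 1 * f u"
      using K fpos[OF u] by (intro mult_right_mono) auto
    then show "f (u * K) \<le> f u"
      using block[OF u, of K] K by simp
    fix y assume y: "y \<in> {1..K}"
    have "2 * y powr \<beta> * f u \<le> 2 * f u"
      using powr_le_1[of y] y fpos[OF u] by (intro mult_right_mono) auto
    then show "f (u * y) \<le> 2 * f u"
      using block[OF u y] by simp
  qed simp
  have "\<bar>f (u * y) / f u - y powr \<beta>\<bar> \<le> \<epsilon>" if u: "u \<ge> U" and y: "y \<ge> 1" for u y
  proof (cases "y \<le> K")
    case True
    have "\<bar>f (u * y) / f u - y powr \<beta>\<bar> \<le> \<eta> * y powr \<beta>"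
      using unif u y True by simp
    also have "\<dots> \<le> \<epsilon> * 1"
      using \<open>\<eta> > 0\<close> \<open>\<eta> \<le> \<epsilon>\<close> powr_le_1[OF y] by (intro mult_mono) auto
    finally show ?thesis by simp
  next
    case False
    have uK: "u * K \<ge> U"
      using u \<open>K > 1\<close> \<open>U > 0\<close> mult_left_mono[of 1 K u] by linarith
    have uy: "u * y \<ge> U"
      using u y \<open>U > 0\<close> mult_left_mono[of 1 y u] by linarith
    have "f (u * y) \<le> 2 * f (u * K)"
      using bound[OF uK, of "y / K"] False \<open>K > 1\<close> by (simp add: field_simps)
    also have "\<dots> \<le> 2 * (2 * K powr \<beta> * f u)"
      by (rule mult_left_mono[OF block[OF u]]) (use K in auto)
    also have "\<dots> \<le> 4 * (\<epsilon>/4) * f u"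
      using K fpos[OF u] mult_right_mono[of "4 * K powr \<beta>" "4 * (\<epsilon>/4)" "f u"] by simp
    finally have "f (u * y) / f u \<le> \<epsilon>"
      using fpos[OF u] by (simp add: field_simps)
    moreover have "f (u * y) / f u \<ge> 0"
      using fpos[OF u] fpos[OF uy] by simp
    moreover have "y powr \<beta> \<le> K powr \<beta>"
      using False K \<open>\<beta> < 0\<close> by (intro powr_mono2') auto
    then have "y powr \<beta> \<le> \<epsilon>"
      using K \<open>\<epsilon> > 0\<close> by linarith
    ultimately show ?thesis
      using powr_ge_zero[of y \<beta>] by linarith
  qed
  then show ?thesis
    unfolding eventually_at_top_linorder by blast
qed

section \<open>The extended Pareto approximation\<close>

lemma powr_linearization:
  fixes p :: real
  assumes "\<epsilon> > 0"
  obtains \<eta> where "\<eta> > 0" "\<And>x. \<bar>x\<bar> < \<eta> \<Longrightarrow> \<bar>(1 + x) powr p - (1 + p * x)\<bar> \<le> \<epsilon> * \<bar>x\<bar>"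
proof -
  have "((\<lambda>x. (1 + x) powr p) has_field_derivative p) (at 0)"
    by (auto intro!: derivative_eq_intros)
  then have "((\<lambda>x. (1 + x) powr p) has_derivative (\<lambda>x. p * x)) (at 0)"
    by (simp add: has_field_derivative_def)
  then obtain \<eta> where "\<eta> > 0"
    "\<And>x. norm (x - 0) < \<eta> \<Longrightarrow>
      norm ((1 + x) powr p - (1 + 0) powr p - p * (x - 0)) \<le> \<epsilon> * norm (x - 0)"
    using assms unfolding has_derivative_at_alt by blast
  then show ?thesis
    by (intro that[of \<eta>]) (auto simp: algebra_simps)
qed

lemma survival_EPD:
  assumes "y \<ge> 1" "1 + \<delta> * (1 - y powr \<tau>) \<ge> 0"
  shows "survival (EPD \<gamma> \<delta> \<tau>) y = y powr (-1/\<gamma>) * (1 + \<delta> * (1 - y powr \<tau>)) powr (-1/\<gamma>)"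
proof (cases "y = 1")
  case False
  then show ?thesis
    using assms by (simp add: survival_def EPD_def powr_mult[symmetric] algebra_simps)
qed (simp add: survival_def EPD_def)

text \<open>
  The comparison at a single \<open>y\<close>, where \<open>v = y\<^sup>\<tau>\<close> and \<open>w\<close> is the factor \<open>(1 + d (1 - v))\<^sup>-\<^sup>1\<^sup>/\<^sup>\<gamma>\<close>,
  known through its linearization. The error splits into three parts of size at most \<open>\<epsilon> \<bar>d\<bar>\<close> each: the error of \<open>r\<close> against \<open>v\<close>, the
  quadratic error \<open>d\<^sup>2 (r - 1) / (\<gamma> (\<gamma> + d))\<close> of replacing \<open>\<gamma> + d\<close> by \<open>\<gamma>\<close>, and the linearization
  error of \<open>w\<close>.
\<close>

lemma first_order_ratio_estimate:
  fixes \<gamma> d r v w \<epsilon> :: real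
  assumes "\<gamma> > 0" "\<bar>d\<bar> \<le> \<gamma>/2" "\<bar>d\<bar> \<le> \<epsilon> * \<gamma>\<^sup>2 / 4"
    and r: "0 \<le> r" "r \<le> 2" "\<bar>r - v\<bar> \<le> \<epsilon> * \<gamma>"
    and w: "\<bar>w - (1 - d * (1 - v) / \<gamma>)\<bar> \<le> \<epsilon> * \<bar>d\<bar>"
  shows "\<bar>(1 + d * r / \<gamma>) / (1 + d / \<gamma>) - w\<bar> \<le> 3 * \<epsilon> * \<bar>d\<bar>"
proof -
  have gd: "\<gamma> + d \<ge> \<gamma>/2" "\<gamma> + d > 0"
    using assms by linarith+
  have *: "(1 + d * r / \<gamma>) / (1 + d / \<gamma>) = 1 + d * ((r - 1) / (\<gamma> + d))"
    proof -
    have "(1 + d * r / \<gamma>) / (1 + d / \<gamma>) = (\<gamma> + d * r) / (\<gamma> + d)"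
      using \<open>\<gamma> > 0\<close> gd(2) by (simp add: add_divide_eq_if_simps)
    also have "\<dots> = 1 + d * ((r - 1) / (\<gamma> + d))"
      using gd(2) by (simp add: add_divide_eq_if_simps algebra_simps)
    finally show ?thesis .
  qed
  have "(1 + d * r / \<gamma>) / (1 + d / \<gamma>) - w
      = d * ((r - v) / \<gamma>) - d * (d * (r - 1) / (\<gamma> * (\<gamma> + d))) - (w - (1 - d * (1 - v) / \<gamma>))"
    unfolding * using \<open>\<gamma> > 0\<close> gd(2) by (simp add: divide_simps) (simp add: algebra_simps)
  moreover have "\<bar>d * ((r - v) / \<gamma>)\<bar> \<le> \<bar>d\<bar> * \<epsilon>"
    unfolding abs_mult using \<open>\<gamma> > 0\<close> r by (intro mult_left_mono) (auto simp: field_simps)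
  moreover have "\<bar>d * (d * (r - 1) / (\<gamma> * (\<gamma> + d)))\<bar> \<le> \<bar>d\<bar> * \<epsilon>"
    unfolding abs_mult
  proof (rule mult_left_mono)
    have "\<bar>d * (r - 1)\<bar> \<le> \<bar>d\<bar> * 1"
      unfolding abs_mult using r by (intro mult_left_mono) auto
    also have "\<dots> \<le> \<epsilon> * \<gamma>\<^sup>2 / 4"
      using assms by simp
    finally have "\<bar>d * (r - 1)\<bar> \<le> \<epsilon> * \<gamma>\<^sup>2 / 4" .
    moreover have "\<epsilon> \<ge> 0"
    proof -
      have "0 \<le> \<epsilon> * \<gamma>\<^sup>2"
        using assms(3) abs_ge_zero[of d] by linarith
      then show ?thesis
        using \<open>\<gamma> > 0\<close> by (simp add: zero_le_mult_iff)
    qed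
    moreover have "\<gamma> * (\<gamma>/2) \<le> \<gamma> * (\<gamma> + d)"
      using gd \<open>\<gamma> > 0\<close> by (intro mult_left_mono) auto
    ultimately have "\<bar>d * (r - 1)\<bar> / (\<gamma> * (\<gamma> + d)) \<le> (\<epsilon> * \<gamma>\<^sup>2 / 4) / (\<gamma> * (\<gamma>/2))"
      using \<open>\<gamma> > 0\<close> by (intro frac_le) auto
    also have "\<dots> \<le> \<epsilon>"
      using \<open>\<gamma> > 0\<close> \<open>\<epsilon> \<ge> 0\<close> by (simp add: power2_eq_square)
    finally show "\<bar>d * (r - 1) / (\<gamma> * (\<gamma> + d))\<bar> \<le> \<epsilon>"
      using \<open>\<gamma> > 0\<close> gd by (simp add: abs_mult)
  qed simp
  moreover have "\<bar>z\<bar> \<le> 3 * k"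
    if "z = a - b - e" "\<bar>a\<bar> \<le> k" "\<bar>b\<bar> \<le> k" "\<bar>e\<bar> \<le> k" for z a b e k :: real
    using that by linarith
  ultimately have "\<bar>(1 + d * r / \<gamma>) / (1 + d / \<gamma>) - w\<bar> \<le> 3 * (\<bar>d\<bar> * \<epsilon>)"
    using w by (metis mult.commute)
  then show ?thesis
    by (simp add: ac_simps)
qed

text \<open>
  The constant sign of \<open>\<delta>\<close> lets \<open>\<bar>\<delta>(uy)\<bar> / \<bar>\<delta>(u)\<bar>\<close>, which is what regular variation controls, stand
  for the signed ratio \<open>\<delta>(uy) / \<delta>(u)\<close>. All thresholds on \<open>u\<close> are chosen before \<open>y\<close>, which gives
  the uniformity.
\<close>

lemma EPD_uniform_error:
  assumes "\<gamma> > 0" "\<tau> < 0" and F: "second_order_pareto \<gamma> \<tau> F \<delta>" and "c > 0"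
  shows "eventually (\<lambda>u. \<forall>y\<ge>1. \<bar>survival F (u * y) / survival F u
           - survival (EPD \<gamma> (\<delta> u) \<tau>) y\<bar> \<le> c * \<bar>\<delta> u\<bar>) at_top"
proof -
  obtain C where "C > 0"
    and eq: "\<And>x. x > 0 \<Longrightarrow> survival F x = C * x powr (-1/\<gamma>) * (1 + \<delta> x / \<gamma>)"
    using F unfolding second_order_pareto_def by blast
  have rv: "regularly_varying (\<lambda>x. \<bar>\<delta> x\<bar>) \<tau>"
    using F unfolding second_order_pareto_def by blast
  have "eventually (\<lambda>x. \<delta> x > 0) at_top \<or> eventually (\<lambda>x. \<delta> x < 0) at_top"
    using F unfolding second_order_pareto_def by blast
  then obtain U0 where sign: "(\<forall>x\<ge>U0. \<delta> x > 0) \<or> (\<forall>x\<ge>U0. \<delta> x < 0)"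
    unfolding eventually_at_top_linorder by blast
  define \<epsilon> where "\<epsilon> = c / 3"
  have "\<epsilon> > 0"
    using \<open>c > 0\<close> by (simp add: \<epsilon>_def)
  obtain \<eta> where "\<eta> > 0"
    and lin: "\<And>x. \<bar>x\<bar> < \<eta> \<Longrightarrow> \<bar>(1 + x) powr (-1/\<gamma>) - (1 + (-1/\<gamma>) * x)\<bar> \<le> \<epsilon> * \<bar>x\<bar>"
    using powr_linearization[OF \<open>\<epsilon> > 0\<close>] by blast
  define b where "b = min (min \<eta> 1) (min (\<gamma>/2) (\<epsilon> * \<gamma>\<^sup>2 / 4))"
  have "b > 0"
    using \<open>\<eta> > 0\<close> \<open>\<gamma> > 0\<close> \<open>\<epsilon> > 0\<close> by (simp add: b_def)
  have "eventually (\<lambda>u. \<bar>\<delta> u\<bar> < b) at_top"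
    using order_tendstoD(2)[OF tendsto_rabs[OF second_order_pareto_tendsto_0[OF \<open>\<gamma> > 0\<close> F]], of b]
      \<open>b > 0\<close> by simp
  moreover have "min (\<epsilon> * \<gamma>) 1 > 0"
    using \<open>\<epsilon> > 0\<close> \<open>\<gamma> > 0\<close> by simp
  from regularly_varying_uniform_at_infinity[OF rv \<open>\<tau> < 0\<close> this]
  have "eventually (\<lambda>u. \<forall>y\<ge>1. \<bar>\<bar>\<delta> (u * y)\<bar> / \<bar>\<delta> u\<bar> - y powr \<tau>\<bar> \<le> min (\<epsilon> * \<gamma>) 1) at_top" .
  ultimately show ?thesis
    using eventually_gt_at_top[of "max U0 0"]
  proof eventually_elim
    case (elim u)
    define d where "d = \<delta> u"
    have d: "\<bar>d\<bar> < \<eta>" "\<bar>d\<bar> < 1" "\<bar>d\<bar> \<le> \<gamma>/2" "\<bar>d\<bar> \<le> \<epsilon> * \<gamma>\<^sup>2 / 4"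
      using elim(1) by (auto simp: b_def d_def)
    have u: "u \<ge> U0" "u > 0"
      using elim by auto
    show ?case
    proof (intro allI impI)
      fix y :: real assume y: "y \<ge> 1"
      have "u * y \<ge> u"
        using u y by simp
      then have uy: "u * y \<ge> U0" "u * y > 0"
        using u by linarith+
      define r where "r = \<bar>\<delta> (u * y)\<bar> / \<bar>d\<bar>"
      define v where "v = y powr \<tau>"
      define w where "w = (1 + d * (1 - v)) powr (-1/\<gamma>)"
      have v: "0 \<le> v" "v \<le> 1"
        using y \<open>\<tau> < 0\<close> powr_mono[of \<tau> 0 y] by (auto simp: v_def)
      have "0 < d \<and> 0 < \<delta> (u * y) \<or> d < 0 \<and> \<delta> (u * y) < 0"
        using sign u(1) uy(1) by (auto simp: d_def)
      then have dr: "\<delta> (u * y) = d * r"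
        by (auto simp: r_def)
      have rv_le: "\<bar>r - v\<bar> \<le> \<epsilon> * \<gamma>" "\<bar>r - v\<bar> \<le> 1"
        using elim(2) y by (auto simp: r_def v_def d_def)
      have r: "0 \<le> r" "r \<le> 2"
        using rv_le v by (auto simp: r_def)
      have x: "\<bar>d * (1 - v)\<bar> \<le> \<bar>d\<bar>"
        unfolding abs_mult using v by (intro mult_left_le) auto
      have "\<bar>w - (1 + (-1/\<gamma>) * (d * (1 - v)))\<bar> \<le> \<epsilon> * \<bar>d * (1 - v)\<bar>"
        unfolding w_def using x d by (intro lin) auto
      also have "\<dots> \<le> \<epsilon> * \<bar>d\<bar>"
        using x \<open>\<epsilon> > 0\<close> by (intro mult_left_mono) auto
      finally have w: "\<bar>w - (1 - d * (1 - v) / \<gamma>)\<bar> \<le> \<epsilon> * \<bar>d\<bar>"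
        by simp
      have EPD: "survival (EPD \<gamma> d \<tau>) y = y powr (-1/\<gamma>) * w"
        unfolding w_def v_def using x d y by (intro survival_EPD) (auto simp: v_def)
      have "survival F (u * y) / survival F u
          = y powr (-1/\<gamma>) * ((1 + d * r / \<gamma>) / (1 + d / \<gamma>))"
        using \<open>C > 0\<close> u(2) uy(2) y by (simp add: eq powr_mult dr d_def[symmetric])
      then have "\<bar>survival F (u * y) / survival F u - survival (EPD \<gamma> d \<tau>) y\<bar>
          = y powr (-1/\<gamma>) * \<bar>(1 + d * r / \<gamma>) / (1 + d / \<gamma>) - w\<bar>"
        unfolding EPD by (simp only: right_diff_distrib[symmetric] abs_mult) simp
      also have "\<dots> \<le> 1 * (3 * \<epsilon> * \<bar>d\<bar>)"
      proof (rule mult_mono)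
        show "y powr (-1/\<gamma>) \<le> 1"
          using y \<open>\<gamma> > 0\<close> powr_mono[of "-1/\<gamma>" 0 y] by auto
        show "\<bar>(1 + d * r / \<gamma>) / (1 + d / \<gamma>) - w\<bar> \<le> 3 * \<epsilon> * \<bar>d\<bar>"
          by (rule first_order_ratio_estimate[OF \<open>\<gamma> > 0\<close> d(3,4) r rv_le(1) w])
      qed auto
      finally show "\<bar>survival F (u * y) / survival F u - survival (EPD \<gamma> (\<delta> u) \<tau>) y\<bar>
          \<le> c * \<bar>\<delta> u\<bar>"
        by (simp add: \<epsilon>_def d_def)
    qed
  qed
qed

theorem proposition2p3:
  fixes \<gamma> \<tau> :: real and F \<delta> :: "real \<Rightarrow> real"
  assumes "\<gamma> > 0" and "\<tau> < 0"
    and "second_order_pareto \<gamma> \<tau> F \<delta>"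
  shows
    "(\<lambda>u. SUP y\<in>{1..}. \<bar>survival F (u * y) / survival F u
                          - survival (EPD \<gamma> (\<delta> u) \<tau>) y\<bar>) \<in> o[at_top](\<lambda>u. \<bar>\<delta> u\<bar>) \<and>
     (\<lambda>u. SUP x\<in>{0..}. \<bar>survival F (u + x) / survival F u
                          - survival (EGPD \<gamma> (\<delta> u) \<tau>) (x / u)\<bar>) \<in> o[at_top](\<lambda>u. \<bar>\<delta> u\<bar>)"
proof (intro conjI landau_o.smallI)
  fix c :: real assume "c > 0"
  note bound = EPD_uniform_error[OF assms \<open>c > 0\<close>]
  show "eventually (\<lambda>u. norm (SUP y\<in>{1..}. \<bar>survival F (u * y) / survival F u
      - survival (EPD \<gamma> (\<delta> u) \<tau>) y\<bar>) \<le> c * norm \<bar>\<delta> u\<bar>) at_top"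
    using bound
  proof eventually_elim
    case (elim u)
    then show ?case
      unfolding real_norm_def by (intro cSup_abs_le) auto
  qed
  show "eventually (\<lambda>u. norm (SUP x\<in>{0..}. \<bar>survival F (u + x) / survival F u
      - survival (EGPD \<gamma> (\<delta> u) \<tau>) (x / u)\<bar>) \<le> c * norm \<bar>\<delta> u\<bar>) at_top"
    using bound eventually_gt_at_top[of 0]
  proof eventually_elim
    case (elim u)
    have "\<bar>survival F (u + x) / survival F u - survival (EGPD \<gamma> (\<delta> u) \<tau>) (x / u)\<bar> \<le> c * \<bar>\<delta> u\<bar>"
      if "x \<ge> 0" for x
    proof -
      have "u + x = u * (1 + x / u)" "1 + x / u \<ge> 1"
        using that elim(2) by (auto simp: field_simps)
      then show ?thesis
        using elim(1) by (simp add: survival_def EGPD_def)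
    qed
    then show ?case
      unfolding real_norm_def by (intro cSup_abs_le) auto
  qed
qed

end
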